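(* Let $(S,\cdot)$ be a semigroup satisfying the Strong F\o lner Condition, let $A\subseteq S$, and let $\delta=d(A)$. Then there is a F\o lner net $\langle F_\alpha\rangle_{\alpha\in D}$ in ${\mathcal P}_f(S)$ such that $\left\langle |F_\alpha\cap A|/|F_\alpha|\right\rangle_{\alpha\in D}$ converges to $\delta$. Moreover, if $\nu$ is any cluster point of the net $\langle\mu_{F_\alpha}\rangle_{\alpha\in D}$ in the weak* topology, then $\nu\in LIM_0(S)$ and $\nu(\chi_A)=\delta$. In particular $d(A)\le d^*(A)$.
   Context: ${\mathcal P}_f(S)$ is the set of finite nonempty subsets of $S$. $S$ satisfies the Strong F\o lner Condition if for every $H\in{\mathcal P}_f(S)$, $\epsilon>0$ there is $K\in{\mathcal P}_f(S)$ with $|K\setminus sK|<\epsilon|K|$ for all $s\in H$. $d(A)$ is the supremum of $\alpha\in[0,1]$ such that for every $H\in{\mathcal P}_f(S)$, $\epsilon>0$ there is $K\in{\mathcal P}_f(S)$ with $|K\setminus sK|<\epsilon|K|$ for all $s\in H$ and $|A\cap K|\ge\alpha|K|$. A F\o lner net is a net $\langle F_\alpha\rangle_{\alpha\in D}$ in ${\mathcal P}_f(S)$ with $\lim_\alpha |F_\alpha\setminus sF_\alpha|/|F_\alpha|=0$ for every $s\in S$. For $F\in{\mathcal P}_f(S)$, $\mu_F(g)=\frac1{|F|}\sum_{t\in F}g(t)$ for $g\in l_\infty(S)$ (bounded real functions). The weak* topology on $l_\infty(S)^*$ is that of pointwise convergence on $l_\infty(S)$. $LIM_0(S)$ is the set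 of all weak* cluster points of nets $\langle\mu_{F_\alpha}\rangle$ with $\langle F_\alpha\rangle$ a F\o lner net. A mean is a continuous linear functional $\mu$ with $\|\mu\|=1$ and $\mu\ge0$ on nonnegative functions; it is left invariant if $\mu(g\circ\lambda_s)=\mu(g)$, $\lambda_s(y)=sy$; $d^*(A)=\sup\{\lambda(\chi_A):\lambda$ a left invariant mean$\}$. *)

theory Defs
  imports "HOL-Analysis.Analysis" "HOL-Probability.Discrete_Topology"
begin

subsection \<open>The Folner condition and upper density\<close>

definition Pf :: "'a set set" where
  "Pf = {K. finite K \<and> K \<noteq> {}}"

text \<open>
  Left multiplication need not be injective, so \<open>(*) s ` K\<close> may have fewer elements than \<open>K\<close>.
\<close>

definition folner_approx :: "'a::semigroup_mult set \<Rightarrow> real \<Rightarrow> 'a set \<Rightarrow> bool" where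
  "folner_approx H \<epsilon> K \<longleftrightarrow>
     (\<forall>s\<in>H. real (card (K - (*) s ` K)) < \<epsilon> * real (card K))"

definition strong_folner :: "'a::semigroup_mult itself \<Rightarrow> bool" where
  "strong_folner _ \<longleftrightarrow>
     (\<forall>H\<in>(Pf :: 'a set set). \<forall>\<epsilon>>0. \<exists>K\<in>Pf. folner_approx H \<epsilon> K)"

definition folner_density :: "'a::semigroup_mult set \<Rightarrow> real" where
  "folner_density A =
     Sup {\<alpha>\<in>{0..1}. \<forall>H\<in>Pf. \<forall>\<epsilon>>0. \<exists>K\<in>Pf.
            folner_approx H \<epsilon> K \<and> real (card (A \<inter> K)) \<ge> \<alpha> * real (card K)}"


subsection \<open>Nets\<close>

definition directed_set :: "'i set \<Rightarrow> ('i \<Rightarrow> 'i \<Rightarrow> bool) \<Rightarrow> bool" where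
  "directed_set D le \<longleftrightarrow>
     D \<noteq> {} \<and> (\<forall>a\<in>D. le a a) \<and>
     (\<forall>a\<in>D. \<forall>b\<in>D. \<forall>c\<in>D. le a b \<longrightarrow> le b c \<longrightarrow> le a c) \<and>
     (\<forall>a\<in>D. \<forall>b\<in>D. \<exists>c\<in>D. le a c \<and> le b c)"

text \<open>
  The filter of tails of a directed set: the library's \<open>(x \<longlongrightarrow> l) (tails D le)\<close> is convergence
  of the net \<open>x\<close>, and \<open>frequently P (tails D le)\<close> says that \<open>P\<close> holds cofinally in \<open>D\<close>
  (see \<open>eventually_tails\<close> and \<open>frequently_tails\<close> below).
\<close>

definition tails :: "'i set \<Rightarrow> ('i \<Rightarrow> 'i \<Rightarrow> bool) \<Rightarrow> 'i filter" where
  "tails D le = (INF a\<in>D. principal {b\<in>D. le a b})"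

lemma eventually_tails:
  assumes "directed_set D le"
  shows "eventually P (tails D le) \<longleftrightarrow> (\<exists>a\<in>D. \<forall>b\<in>D. le a b \<longrightarrow> P b)"
proof -
  have "eventually P (tails D le) \<longleftrightarrow> (\<exists>a\<in>D. eventually P (principal {b\<in>D. le a b}))"
    unfolding tails_def
  proof (rule eventually_INF_base)
    show "D \<noteq> {}" using assms by (simp add: directed_set_def)
    fix a b assume ab: "a \<in> D" "b \<in> D"
    then obtain c where c: "c \<in> D" "le a c" "le b c"
      using assms unfolding directed_set_def by blast
    have "{d\<in>D. le c d} \<subseteq> {d\<in>D. le a d} \<inter> {d\<in>D. le b d}"
      using assms ab c unfolding directed_set_def by blast
    with c show "\<exists>x\<in>D. principal {d\<in>D. le x d}
        \<le> inf (principal {d\<in>D. le a d}) (principal {d\<in>D. le b d})"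
      by auto
  qed
  then show ?thesis by (auto simp: eventually_principal)
qed

lemma frequently_tails:
  assumes "directed_set D le"
  shows "frequently P (tails D le) \<longleftrightarrow> (\<forall>a\<in>D. \<exists>b\<in>D. le a b \<and> P b)"
  unfolding frequently_def eventually_tails[OF assms] by blast

definition net_cluster_point ::
    "'b topology \<Rightarrow> 'i set \<Rightarrow> ('i \<Rightarrow> 'i \<Rightarrow> bool) \<Rightarrow> ('i \<Rightarrow> 'b) \<Rightarrow> 'b \<Rightarrow> bool" where
  "net_cluster_point X D le x p \<longleftrightarrow>
     p \<in> topspace X \<and>
     (\<forall>U. openin X U \<and> p \<in> U \<longrightarrow> (\<exists>\<^sub>F \<alpha> in tails D le. x \<alpha> \<in> U))"

definition folner_net ::
    "'i set \<Rightarrow> ('i \<Rightarrow> 'i \<Rightarrow> bool) \<Rightarrow> ('i \<Rightarrow> 'a::semigroup_mult set) \<Rightarrow> bool" where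
  "folner_net D le F \<longleftrightarrow>
     directed_set D le \<and> (\<forall>\<alpha>\<in>D. F \<alpha> \<in> Pf) \<and>
     (\<forall>s. ((\<lambda>\<alpha>. real (card (F \<alpha> - (*) s ` F \<alpha>)) / real (card (F \<alpha>))) \<longlongrightarrow> 0) (tails D le))"


subsection \<open>Bounded functions, means and the weak* topology\<close>

text \<open>
  Every function on the type \<open>'a discrete\<close> is continuous, so its bounded continuous real functions
  are exactly the bounded real functions on \<open>'a\<close>, with the supremum norm.
\<close>

type_synonym 'a linf = "'a discrete \<Rightarrow>\<^sub>C real"

type_synonym 'a linf_dual = "'a linf \<Rightarrow>\<^sub>L real"

definition val :: "'a linf \<Rightarrow> 'a \<Rightarrow> real" where
  "val g x = apply_bcontfun g (discrete x)"

definition linf_of :: "('a \<Rightarrow> real) \<Rightarrow> 'a linf" where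
  "linf_of f = Bcontfun (\<lambda>x. f (of_discrete x))"

lemma val_linf_of:
  assumes "bounded (range f)"
  shows "val (linf_of f) = f"
proof -
  have "continuous_on UNIV (\<lambda>x. f (of_discrete x))"
    by (simp add: continuous_on_open_vimage open_discrete)
  moreover have "bounded (range (\<lambda>x. f (of_discrete x)))"
    by (rule bounded_subset[OF assms]) auto
  ultimately have "(\<lambda>x. f (of_discrete x)) \<in> bcontfun"
    by (simp add: bcontfun_def)
  then show ?thesis
    by (simp add: val_def linf_of_def Bcontfun_inverse discrete_inverse fun_eq_iff)
qed

lemma bounded_val: "bounded (range (val g))"
  by (rule bounded_subset[OF bounded_apply_bcontfun[of g]]) (auto simp: val_def)

lemma linf_of_val: "linf_of (val g) = g"
  by (simp add: linf_of_def val_def of_discrete_inverse apply_bcontfun_inverse)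

lemma norm_linf: "norm g = (SUP x. \<bar>val g x\<bar>)"
proof -
  have "norm g = (SUP y. \<bar>apply_bcontfun g y\<bar>)"
    by (simp add: norm_bcontfun_def dist_bcontfun.rep_eq)
  also have "range (\<lambda>y. \<bar>apply_bcontfun g y\<bar>) = range (\<lambda>x. \<bar>val g x\<bar>)"
    unfolding val_def
  proof (intro equalityI image_subsetI)
    fix y :: "'a discrete"
    have "y = discrete (of_discrete y)" by (simp add: of_discrete_inverse)
    then show "\<bar>apply_bcontfun g y\<bar> \<in> range (\<lambda>x. \<bar>apply_bcontfun g (discrete x)\<bar>)"
      by (metis rangeI)
  qed simp
  finally show ?thesis .
qed

definition chi :: "'a set \<Rightarrow> 'a linf" where
  "chi A = linf_of (indicat_real A)"

lemma val_chi: "val (chi A) = indicat_real A"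
  unfolding chi_def
  by (rule val_linf_of) (rule boundedI[where B = 1], auto simp: indicator_def)

definition ltrans :: "'a::semigroup_mult \<Rightarrow> 'a linf \<Rightarrow> 'a linf" where
  "ltrans s g = linf_of (val g \<circ> (*) s)"

lemma val_ltrans: "val (ltrans s g) y = val g (s * y)"
proof -
  have "bounded (range (val g \<circ> (*) s))"
    by (rule bounded_subset[OF bounded_val[of g]]) auto
  then show ?thesis by (simp add: ltrans_def val_linf_of)
qed

definition mu :: "'a set \<Rightarrow> 'a linf_dual" where
  "mu F = Blinfun (\<lambda>g. 1 / real (card F) * (\<Sum>t\<in>F. val g t))"

lemma mu_apply: "blinfun_apply (mu F) g = 1 / real (card F) * (\<Sum>t\<in>F. val g t)"
proof -
  have "bounded_linear (\<lambda>g::'a linf. val g t)" for t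
  proof (rule bounded_linear_intro[where K = 1])
    show "norm (val g t) \<le> norm g * 1" for g
      using norm_bounded[of g "discrete t"] by (simp add: val_def)
  qed (simp_all add: val_def)
  then have "bounded_linear (\<lambda>g::'a linf. 1 / real (card F) * (\<Sum>t\<in>F. val g t))"
    by (intro bounded_linear_const_mult bounded_linear_sum)
  then show ?thesis by (simp add: mu_def bounded_linear_Blinfun_apply)
qed

text \<open>
  The library's strong operator topology is pointwise convergence of bounded operators; for operators
  into \<open>real\<close>, that is, on a dual space, this is the weak* topology.
\<close>

abbreviation weak_star :: "'a linf_dual topology" where
  "weak_star \<equiv> strong_operator_topology"

definition is_mean :: "'a linf_dual \<Rightarrow> bool" where
  "is_mean \<mu> \<longleftrightarrow> norm \<mu> = 1 \<and> (\<forall>g. (\<forall>x. 0 \<le> val g x) \<longrightarrow> 0 \<le> blinfun_apply \<mu> g)"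

definition left_invariant :: "'a::semigroup_mult linf_dual \<Rightarrow> bool" where
  "left_invariant \<mu> \<longleftrightarrow> (\<forall>s g. blinfun_apply \<mu> (ltrans s g) = blinfun_apply \<mu> g)"

definition banach_density :: "'a::semigroup_mult set \<Rightarrow> real" where
  "banach_density A = Sup {blinfun_apply \<mu> (chi A) | \<mu>. is_mean \<mu> \<and> left_invariant \<mu>}"


subsection \<open>The set of weak* cluster points of Folner nets\<close>

text \<open>
  HOL cannot quantify over all index types of nets inside a definition or an existential statement,
  so one type is fixed.  It is large enough: by \<open>folner_net_reindex\<close>, every Folner net over any
  index type can be replaced by one over \<open>'a net_index\<close> that visits the same sets and has the
  same image filter, hence the same limits and cluster points.  In particular \<open>LIM0\<close> contains
  the cluster points of Folner nets over arbitrary index types (\<open>LIM0_I\<close>).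
\<close>

type_synonym 'a net_index = "'a set \<times> 'a set set"

definition LIM0 :: "'a::semigroup_mult linf_dual set" where
  "LIM0 = {\<nu>. \<exists>(D :: 'a net_index set) le F.
              folner_net D le F \<and> net_cluster_point weak_star D le (\<lambda>\<alpha>. mu (F \<alpha>)) \<nu>}"

lemma net_reindex:
  fixes F :: "'i \<Rightarrow> 'b"
  assumes dir: "directed_set D le"
  obtains D' :: "('b \<times> 'b set) set" and le' G
  where "directed_set D' le'" "G ` D' \<subseteq> F ` D"
    "filtermap G (tails D' le') = filtermap F (tails D le)"
proof -
  let ?\<Phi> = "filtermap F (tails D le)"
  define D' where "D' = {(x, B). x \<in> B \<and> B \<subseteq> F ` D \<and> eventually (\<lambda>y. y \<in> B) ?\<Phi>}"
  define le' :: "'b \<times> 'b set \<Rightarrow> 'b \<times> 'b set \<Rightarrow> bool" where "le' = (\<lambda>p q. snd q \<subseteq> snd p)"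
  have nonbot: "\<exists>x. x \<in> B" if B: "eventually (\<lambda>y. y \<in> B) ?\<Phi>" for B
  proof -
    from B obtain a where "a \<in> D" "\<forall>b\<in>D. le a b \<longrightarrow> F b \<in> B"
      by (auto simp: eventually_filtermap eventually_tails[OF dir])
    then show ?thesis using dir unfolding directed_set_def by blast
  qed
  have top: "eventually (\<lambda>y. y \<in> F ` D) ?\<Phi>"
  proof -
    from dir obtain a where "a \<in> D" unfolding directed_set_def by blast
    then show ?thesis unfolding eventually_filtermap eventually_tails[OF dir] by blast
  qed
  have D'_iff: "(x, B) \<in> D' \<longleftrightarrow> x \<in> B \<and> B \<subseteq> F ` D \<and> eventually (\<lambda>y. y \<in> B) ?\<Phi>" for x B
    by (simp only: D'_def mem_Collect_eq case_prod_conv)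
  have dir': "directed_set D' le'"
    unfolding directed_set_def
  proof (intro conjI ballI impI)
    obtain x where "x \<in> F ` D" using nonbot[OF top] ..
    then have "(x, F ` D) \<in> D'" using top unfolding D'_iff by (intro conjI subset_refl)
    then show "D' \<noteq> {}" by blast
    show "le' a a" if "a \<in> D'" for a by (simp add: le'_def)
    show "le' a c" if "le' a b" "le' b c" for a b c using that by (auto simp: le'_def)
    fix a b assume "a \<in> D'" "b \<in> D'"
    then obtain x B y C where ab: "a = (x, B)" "b = (y, C)" "B \<subseteq> F ` D"
      and ev: "eventually (\<lambda>y. y \<in> B) ?\<Phi>" "eventually (\<lambda>y. y \<in> C) ?\<Phi>"
      by (auto simp: D'_def)
    have ev': "eventually (\<lambda>y. y \<in> B \<inter> C) ?\<Phi>"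
      using ev unfolding Int_iff by (rule eventually_conj)
    from nonbot[OF ev'] obtain z where "z \<in> B \<inter> C" ..
    with ev' ab have "(z, B \<inter> C) \<in> D'" "le' a (z, B \<inter> C)" "le' b (z, B \<inter> C)"
      by (auto simp: D'_def le'_def)
    then show "\<exists>c\<in>D'. le' a c \<and> le' b c" by blast
  qed
  have "filtermap fst (tails D' le') = ?\<Phi>"
  proof (rule filter_eqI)
    fix P :: "'b \<Rightarrow> bool"
    have "eventually P (filtermap fst (tails D' le'))
            \<longleftrightarrow> (\<exists>p\<in>D'. \<forall>q\<in>D'. snd q \<subseteq> snd p \<longrightarrow> P (fst q))"
      by (simp only: eventually_filtermap eventually_tails[OF dir']) (simp only: le'_def)
    also have "\<dots> \<longleftrightarrow> eventually P ?\<Phi>"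
    proof
      assume "\<exists>p\<in>D'. \<forall>q\<in>D'. snd q \<subseteq> snd p \<longrightarrow> P (fst q)"
      then obtain x B where B: "(x, B) \<in> D'" "\<forall>q\<in>D'. snd q \<subseteq> B \<longrightarrow> P (fst q)" by auto
      have "P y" if "y \<in> B" for y
      proof -
        have "(y, B) \<in> D'" using B(1) that by (auto simp: D'_def)
        with B(2) show ?thesis by fastforce
      qed
      moreover have "eventually (\<lambda>y. y \<in> B) ?\<Phi>" using B(1) by (auto simp: D'_def)
      ultimately show "eventually P ?\<Phi>" by (auto elim: eventually_mono)
    next
      assume P: "eventually P ?\<Phi>"
      define B where "B = {y \<in> F ` D. P y}"
      have ev: "eventually (\<lambda>y. y \<in> B) ?\<Phi>"
        using eventually_conj[OF top P] by (simp add: B_def)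
      from nonbot[OF ev] obtain x where "x \<in> B" ..
      with ev have "(x, B) \<in> D'" by (auto simp: D'_def B_def)
      moreover have "\<forall>q\<in>D'. snd q \<subseteq> B \<longrightarrow> P (fst q)" by (auto simp: D'_def B_def)
      ultimately show "\<exists>p\<in>D'. \<forall>q\<in>D'. snd q \<subseteq> snd p \<longrightarrow> P (fst q)" by force
    qed
    finally show "eventually P (filtermap fst (tails D' le')) \<longleftrightarrow> eventually P ?\<Phi>" .
  qed
  moreover have "fst ` D' \<subseteq> F ` D" by (auto simp: D'_def)
  ultimately show ?thesis using that dir' by blast
qed

lemma folner_net_reindex:
  fixes F :: "'i \<Rightarrow> 'a::semigroup_mult set"
  assumes F: "folner_net D le F"
  obtains D' :: "'a net_index set" and le' G
  where "folner_net D' le' G" "G ` D' \<subseteq> F ` D"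
    "filtermap G (tails D' le') = filtermap F (tails D le)"
proof -
  from F have "directed_set D le" by (simp add: folner_net_def)
  then obtain D' :: "'a net_index set" and le' G
    where G: "directed_set D' le'" "G ` D' \<subseteq> F ` D"
      "filtermap G (tails D' le') = filtermap F (tails D le)"
    by (rule net_reindex)
  have lim: "((\<lambda>\<alpha>. h (G \<alpha>)) \<longlongrightarrow> l) (tails D' le') \<longleftrightarrow> ((\<lambda>\<alpha>. h (F \<alpha>)) \<longlongrightarrow> l) (tails D le)"
    for h :: "'a set \<Rightarrow> real" and l
  proof -
    have "filtermap (\<lambda>\<alpha>. h (G \<alpha>)) (tails D' le') = filtermap (\<lambda>\<alpha>. h (F \<alpha>)) (tails D le)"
      using arg_cong[OF G(3), of "filtermap h"] by (simp only: filtermap_filtermap)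
    then show ?thesis by (simp only: filterlim_def)
  qed
  have "folner_net D' le' G"
    unfolding folner_net_def
  proof (intro conjI ballI allI)
    fix \<alpha> assume "\<alpha> \<in> D'"
    then obtain \<beta> where "\<beta> \<in> D" "G \<alpha> = F \<beta>" using G(2) by blast
    then show "G \<alpha> \<in> Pf" using F by (simp add: folner_net_def)
  next
    fix s
    have "((\<lambda>\<alpha>. real (card (F \<alpha> - (*) s ` F \<alpha>)) / real (card (F \<alpha>))) \<longlongrightarrow> 0) (tails D le)"
      using F by (simp add: folner_net_def)
    then show "((\<lambda>\<alpha>. real (card (G \<alpha> - (*) s ` G \<alpha>)) / real (card (G \<alpha>))) \<longlongrightarrow> 0) (tails D' le')"
      by (rule lim[of "\<lambda>K. real (card (K - (*) s ` K)) / real (card K)", THEN iffD2])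
  qed (rule G(1))
  from that[OF this G(2,3)] show ?thesis .
qed

lemma LIM0_I:
  fixes F :: "'i \<Rightarrow> 'a::semigroup_mult set"
  assumes "folner_net D le F" "net_cluster_point weak_star D le (\<lambda>\<alpha>. mu (F \<alpha>)) \<nu>"
  shows "\<nu> \<in> LIM0"
proof -
  from assms(1) obtain D' :: "'a net_index set" and le' G
    where G: "folner_net D' le' G" "G ` D' \<subseteq> F ` D"
      "filtermap G (tails D' le') = filtermap F (tails D le)"
    by (rule folner_net_reindex)
  have "(\<exists>\<^sub>F \<alpha> in tails D' le'. mu (G \<alpha>) \<in> U) \<longleftrightarrow> (\<exists>\<^sub>F \<alpha> in tails D le. mu (F \<alpha>) \<in> U)" for U
    using arg_cong[OF G(3), of "frequently (\<lambda>K. mu K \<in> U)"] by (simp add: frequently_filtermap)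
  with assms(2) have "net_cluster_point weak_star D' le' (\<lambda>\<alpha>. mu (G \<alpha>)) \<nu>"
    by (simp add: net_cluster_point_def)
  with G(1) show ?thesis unfolding LIM0_def by blast
qed

end

theory Submission
  imports Defs
begin

text \<open>
  Index the net by pairs \<open>(H, n)\<close> and let \<open>F (H, n)\<close> witness both the Folner condition for
  \<open>(H, 1 / (n + 1))\<close> and the density bound \<open>\<delta> - 1 / (n + 1)\<close>.  No \<open>\<alpha> > \<delta>\<close> qualifies in the
  supremum defining the density, so some \<open>(H, \<epsilon>)\<close> bounds the relative density of \<open>A\<close> in \<^emph>\<open>every\<close>
  Folner set for \<open>(H, \<epsilon>)\<close> from above; hence the densities along the net converge to \<open>\<delta>\<close>.
  By Tychonoff's theorem the averages \<open>mu (F \<alpha>)\<close> have a pointwise cluster point.  It is a mean,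
  it is left invariant because \<open>mu F\<close> is nearly invariant for a Folner set \<open>F\<close>, and it takes the
  value \<open>\<delta>\<close> at the indicator function of \<open>A\<close>.
\<close>

section \<open>Bounds and near invariance of the averages \<open>mu F\<close>\<close>

lemma abs_val_le_norm: "\<bar>val g x\<bar> \<le> norm g"
  using norm_bounded[of g "discrete x"] by (simp add: val_def)

lemma norm_chi_le: "norm (chi A) \<le> 1"
  unfolding norm_linf val_chi by (rule cSUP_least) (auto simp: indicator_def)

lemma mu_chi: "finite F \<Longrightarrow> blinfun_apply (mu F) (chi A) = real (card (F \<inter> A)) / real (card F)"
  by (simp add: mu_apply val_chi sum.If_cases indicator_def)

lemma mu_nonneg: "(\<And>x. 0 \<le> val g x) \<Longrightarrow> 0 \<le> blinfun_apply (mu F) g"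
  by (simp add: mu_apply sum_nonneg)

lemma abs_mu_le_norm: "\<bar>blinfun_apply (mu F) g\<bar> \<le> norm g"
proof -
  have "\<bar>\<Sum>t\<in>F. val g t\<bar> \<le> (\<Sum>t\<in>F. \<bar>val g t\<bar>)" by (rule sum_abs)
  also have "\<dots> \<le> real (card F) * norm g"
    by (rule sum_bounded_above) (rule abs_val_le_norm)
  finally show ?thesis
    \<comment> \<open>\<open>card F = 0\<close> covers infinite as well as empty \<open>F\<close>;
      division by zero then makes the average 0.\<close>
    by (cases "card F = 0") (auto simp: mu_apply abs_mult field_simps)
qed

text \<open>
  Left multiplication by \<open>s\<close> need not be injective on \<open>F\<close>, so a set \<open>T\<close> of representatives of the
  fibres over \<open>F \<inter> s F\<close> is chosen; \<open>F - T\<close> has as many elements as \<open>F - s F\<close>.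
\<close>

lemma abs_sum_shift_diff_le:
  fixes F :: "'a::semigroup_mult set" and f :: "'a \<Rightarrow> real"
  assumes fin: "finite F" and bound: "\<And>x. \<bar>f x\<bar> \<le> c"
  shows "\<bar>(\<Sum>t\<in>F. f (s * t)) - (\<Sum>t\<in>F. f t)\<bar> \<le> 2 * c * real (card (F - (*) s ` F))"
proof -
  let ?I = "F \<inter> (*) s ` F"
  obtain T where T: "T \<subseteq> F" "inj_on ((*) s) T" "(*) s ` T = ?I"
    using subset_image_inj[of ?I "(*) s" F] by auto
  have "card T = card ?I" using card_image[OF T(2)] T(3) by simp
  moreover have "card (F - T) = card F - card T"
    by (rule card_Diff_subset[OF finite_subset[OF T(1) fin] T(1)])
  moreover have "card (F - (*) s ` F) = card F - card ?I"
    using fin by (simp add: card_Diff_subset_Int)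
  ultimately have card_eq: "card (F - T) = card (F - (*) s ` F)" by simp
  have "(\<Sum>t\<in>F. f (s * t)) = (\<Sum>t\<in>F - T. f (s * t)) + (\<Sum>t\<in>T. f (s * t))"
    by (rule sum.subset_diff[OF T(1) fin])
  also have "(\<Sum>t\<in>T. f (s * t)) = sum f ?I"
    using sum.reindex[OF T(2), of f] T(3) by (simp add: o_def)
  finally have shifted: "(\<Sum>t\<in>F. f (s * t)) = (\<Sum>t\<in>F - T. f (s * t)) + sum f ?I" .
  have "sum f F = sum f (F - ?I) + sum f ?I"
    by (rule sum.subset_diff) (use fin in auto)
  then have plain: "sum f F = sum f (F - (*) s ` F) + sum f ?I"
    by (simp add: Diff_Int)
  have small: "\<bar>\<Sum>t\<in>B. h t\<bar> \<le> real (card B) * c" if "\<And>x. \<bar>h x\<bar> \<le> c" for B and h :: "'a \<Rightarrow> real"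
    by (rule order_trans[OF sum_abs sum_bounded_above]) (rule that)
  have "\<bar>\<Sum>t\<in>F - T. f (s * t)\<bar> \<le> real (card (F - (*) s ` F)) * c"
    using small[of "\<lambda>t. f (s * t)" "F - T"] bound card_eq by simp
  moreover have "\<bar>sum f (F - (*) s ` F)\<bar> \<le> real (card (F - (*) s ` F)) * c"
    by (rule small) (rule bound)
  \<comment> \<open>The common term \<open>sum f ?I\<close> cancels, and the two remainders run over
    sets of equal cardinality; hence the factor 2.\<close>
  ultimately show ?thesis unfolding shifted plain by (simp add: algebra_simps)
qed

lemma abs_mu_ltrans_diff_le:
  assumes "finite F"
  shows "\<bar>blinfun_apply (mu F) (ltrans s g) - blinfun_apply (mu F) g\<bar>
           \<le> 2 * norm g * (real (card (F - (*) s ` F)) / real (card F))"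
proof -
  have "blinfun_apply (mu F) (ltrans s g) - blinfun_apply (mu F) g
          = ((\<Sum>t\<in>F. val g (s * t)) - (\<Sum>t\<in>F. val g t)) / real (card F)"
    by (simp add: mu_apply val_ltrans diff_divide_distrib)
  then show ?thesis
    using abs_sum_shift_diff_le[OF assms, of "val g" "norm g" s]
    by (simp add: abs_val_le_norm divide_right_mono)
qed

section \<open>Compactness and the limiting mean\<close>

lemma tails_neq_bot:
  assumes "directed_set D le"
  shows "tails D le \<noteq> bot"
proof -
  have "\<not> eventually (\<lambda>_. False) (tails D le)"
    unfolding eventually_tails[OF assms] using assms by (auto simp only: directed_set_def)
  then show ?thesis by (simp only: trivial_limit_def not_False_eq_True)
qed

lemma eventually_tails_mem:
  assumes "directed_set D le"
  shows "eventually (\<lambda>\<alpha>. \<alpha> \<in> D) (tails D le)"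
  unfolding eventually_tails[OF assms] using assms by (auto simp only: directed_set_def)

text \<open>A proper subfilter plays the role of a convergent subnet. The image filter has a cluster
  point \<open>p\<close> in \<open>K\<close>, and intersecting \<open>T\<close> with the preimages
  of neighbourhoods of \<open>p\<close> forces convergence to it.\<close>

lemma compact_imp_tendsto_subfilter:
  assumes "compact K" "T \<noteq> bot" "\<And>x. m x \<in> K"
  obtains p G where "G \<noteq> bot" "G \<le> T" "(m \<longlongrightarrow> p) G"
proof -
  have "filtermap m T \<noteq> bot" using assms(2) by (simp add: filtermap_bot_iff)
  moreover have "eventually (\<lambda>y. y \<in> K) (filtermap m T)"
    using assms(3) by (simp add: eventually_filtermap)
  ultimately obtain p where p: "inf (nhds p) (filtermap m T) \<noteq> bot"
    using assms(1) unfolding compact_filter by blast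
  define G where "G = inf T (filtercomap m (nhds p))"
  show ?thesis
  proof
    show "G \<le> T" by (simp add: G_def)
    show "(m \<longlongrightarrow> p) G" by (simp add: G_def filterlim_iff_le_filtercomap)
    show "G \<noteq> bot"
    proof
      assume "G = bot"
      then have "eventually (\<lambda>_. False) G" by simp
      \<comment> \<open>Improperness would give a \<open>T\<close>-large set whose image misses a
        neighbourhood of \<open>p\<close>, so \<open>p\<close> could not be a cluster point.\<close>
      then obtain Q R where Q: "eventually Q T" and R: "eventually R (nhds p)"
        and QR: "\<And>x. Q x \<Longrightarrow> \<not> R (m x)"
        unfolding G_def eventually_inf eventually_filtercomap by blast
      have "eventually (\<lambda>y. \<not> R y) (filtermap m T)"
        using Q unfolding eventually_filtermap by (rule eventually_mono) (rule QR)
      with R have "eventually (\<lambda>_. False) (inf (nhds p) (filtermap m T))"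
        unfolding eventually_inf by blast
      with p show False by (simp add: trivial_limit_def)
    qed
  qed
qed

text \<open>Tychonoff for the product of the intervals [-norm g, norm g]. Every linear functional of
  norm at most 1 lies in it, so this is the compactness behind Banach-Alaoglu; linearity of limits
  is recovered separately.\<close>

lemma compact_PiE_cball: "compact (PiE UNIV (\<lambda>g::'b::real_normed_vector. cball (0::real) (norm g)))"
  using compactin_PiE[of "\<lambda>_. euclidean" UNIV "\<lambda>g::'b. cball (0::real) (norm g)"]
  by (simp add: euclidean_product_topology)

text \<open>The limit \<open>p\<close> is at first only a function. Linearity, the norm bound,
  positivity and the values at indicators pass to it because limits along the proper filter
  \<open>G\<close> are unique and preserve inequalities.\<close>

lemma left_invariant_mean_of_folner_net:
  fixes F :: "'i \<Rightarrow> 'a::semigroup_mult set"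
  assumes F: "folner_net D le F"
    and lim: "((\<lambda>\<alpha>. real (card (F \<alpha> \<inter> A)) / real (card (F \<alpha>))) \<longlongrightarrow> \<delta>) (tails D le)"
  obtains \<mu> where "is_mean \<mu>" "left_invariant \<mu>" "blinfun_apply \<mu> (chi A) = \<delta>"
proof -
  have dir: "directed_set D le" and Pf: "\<And>\<alpha>. \<alpha> \<in> D \<Longrightarrow> F \<alpha> \<in> Pf"
    and inv: "\<And>s. ((\<lambda>\<alpha>. real (card (F \<alpha> - (*) s ` F \<alpha>)) / real (card (F \<alpha>))) \<longlongrightarrow> 0) (tails D le)"
    using F by (auto simp: folner_net_def)
  \<comment> \<open>This holds for all \<alpha>, also outside \<open>D\<close>, because
    \<open>abs_mu_le_norm\<close> puts no condition on the set.\<close>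
  have "blinfun_apply (mu (F \<alpha>)) \<in> PiE UNIV (\<lambda>g. cball 0 (norm g))" for \<alpha>
    by (simp add: PiE_iff abs_mu_le_norm)
  then obtain p G where G: "G \<noteq> bot" "G \<le> tails D le"
      and p: "((\<lambda>\<alpha>. blinfun_apply (mu (F \<alpha>))) \<longlongrightarrow> p) G"
    by (rule compact_imp_tendsto_subfilter[OF compact_PiE_cball tails_neq_bot[OF dir]])
  have evPf: "eventually (\<lambda>\<alpha>. F \<alpha> \<in> Pf) G"
    using eventually_tails_mem[OF dir] Pf by (intro filter_leD[OF G(2)]) (auto elim: eventually_mono)
  \<comment> \<open>Coordinate projections are continuous, so convergence in the product topology
    gives convergence at each \<open>g\<close>.\<close>
  have pt: "((\<lambda>\<alpha>. blinfun_apply (mu (F \<alpha>)) g) \<longlongrightarrow> p g) G" for g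
    using continuous_on_tendsto_compose[OF continuous_on_product_coordinates[of g] p] by simp
  have bound: "\<bar>p g\<bar> \<le> norm g" for g
    by (rule tendsto_upperbound[OF tendsto_rabs[OF pt] always_eventually G(1)]) (intro allI abs_mu_le_norm)
  have "bounded_linear p"
  proof (rule bounded_linear_intro[where K = 1])
    show "p (x + y) = p x + p y" for x y
      using tendsto_add[OF pt[of x] pt[of y]]
      by (intro tendsto_unique[OF G(1) pt]) (simp only: blinfun.add_right)
    show "p (r *\<^sub>R x) = r *\<^sub>R p x" for r x
      using tendsto_scaleR[OF tendsto_const[of r] pt[of x]]
      by (intro tendsto_unique[OF G(1) pt]) (simp only: blinfun.scaleR_right)
    show "norm (p x) \<le> norm x * 1" for x
      using bound by simp
  qed
  then have app: "blinfun_apply (Blinfun p) = p" by (rule bounded_linear_Blinfun_apply)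
  have evUNIV: "eventually (\<lambda>\<alpha>. blinfun_apply (mu (F \<alpha>)) (chi UNIV) = 1) G"
    using evPf by (rule eventually_mono) (auto simp: mu_chi Pf_def card_eq_0_iff)
  have p1: "p (chi UNIV) = 1"
    using tendsto_unique[OF G(1) pt tendsto_eventually[OF evUNIV]] .
  have "p (chi A) = \<delta>"
  proof (rule tendsto_unique[OF G(1) pt])
    have "eventually (\<lambda>\<alpha>. real (card (F \<alpha> \<inter> A)) / real (card (F \<alpha>)) = blinfun_apply (mu (F \<alpha>)) (chi A)) G"
      using evPf by (rule eventually_mono) (auto simp: mu_chi Pf_def)
    then show "((\<lambda>\<alpha>. blinfun_apply (mu (F \<alpha>)) (chi A)) \<longlongrightarrow> \<delta>) G"
      by (rule Lim_transform_eventually[OF filterlim_mono[OF lim order_refl G(2)]])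
  qed
  moreover have "is_mean (Blinfun p)"
    unfolding is_mean_def
  proof (intro conjI allI impI antisym)
    show "norm (Blinfun p) \<le> 1"
      by (rule norm_blinfun_bound) (auto simp: app bound)
    \<comment> \<open>Testing on the constant function 1, of norm at most 1, gives the lower bound
      for the norm.\<close>
    have "1 \<le> norm (Blinfun p) * norm (chi (UNIV :: 'a set))"
      using norm_blinfun[of "Blinfun p" "chi UNIV"] by (simp add: app p1)
    also have "\<dots> \<le> norm (Blinfun p) * 1"
      by (intro mult_left_mono norm_chi_le norm_ge_zero)
    finally show "1 \<le> norm (Blinfun p)" by simp
    show "0 \<le> blinfun_apply (Blinfun p) g" if "\<forall>x. 0 \<le> val g x" for g
      unfolding app using that
      by (intro tendsto_lowerbound[OF pt _ G(1)] always_eventually allI mu_nonneg) simp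
  qed
  moreover have "left_invariant (Blinfun p)"
    unfolding left_invariant_def app
  proof (intro allI)
    fix s :: 'a and g :: "'a linf"
    \<comment> \<open>The invariance defect is squeezed between 0 and a multiple of the Folner
      ratio, which tends to 0.\<close>
    have "eventually (\<lambda>\<alpha>. norm (blinfun_apply (mu (F \<alpha>)) (ltrans s g) - blinfun_apply (mu (F \<alpha>)) g)
            \<le> 2 * norm g * (real (card (F \<alpha> - (*) s ` F \<alpha>)) / real (card (F \<alpha>)))) G"
      using evPf
    proof (rule eventually_mono)
      fix \<alpha> assume "F \<alpha> \<in> Pf"
      then have "finite (F \<alpha>)" by (simp add: Pf_def)
      from abs_mu_ltrans_diff_le[OF this]
      show "norm (blinfun_apply (mu (F \<alpha>)) (ltrans s g) - blinfun_apply (mu (F \<alpha>)) g)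
              \<le> 2 * norm g * (real (card (F \<alpha> - (*) s ` F \<alpha>)) / real (card (F \<alpha>)))"
        by (simp only: real_norm_def)
    qed
    moreover have "((\<lambda>\<alpha>. 2 * norm g * (real (card (F \<alpha> - (*) s ` F \<alpha>)) / real (card (F \<alpha>)))) \<longlongrightarrow> 0) G"
      by (rule tendsto_mult_right_zero[OF filterlim_mono[OF inv order_refl G(2)]])
    ultimately have "((\<lambda>\<alpha>. blinfun_apply (mu (F \<alpha>)) (ltrans s g) - blinfun_apply (mu (F \<alpha>)) g) \<longlongrightarrow> 0) G"
      by (rule Lim_null_comparison)
    then have "p (ltrans s g) - p g = 0"
      by (rule tendsto_unique[OF G(1) tendsto_diff[OF pt pt]])
    then show "p (ltrans s g) = p g" by simp
  qed
  ultimately show ?thesis using that[of "Blinfun p"] by (simp add: app)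
qed

text \<open>Since a mean has norm 1 and \<open>chi A\<close> has norm at most 1, the values lie
  below 1; only for such a bounded set does \<open>Sup\<close> on the reals dominate its
  elements.\<close>

lemma le_banach_density:
  assumes "is_mean \<mu>" "left_invariant \<mu>"
  shows "blinfun_apply \<mu> (chi A) \<le> banach_density A"
  unfolding banach_density_def
proof (rule cSup_upper)
  show "blinfun_apply \<mu> (chi A) \<in> {blinfun_apply \<mu> (chi A) |\<mu>. is_mean \<mu> \<and> left_invariant \<mu>}"
    using assms by blast
  have "blinfun_apply \<nu> (chi A) \<le> 1" if "is_mean \<nu>" for \<nu>
    using norm_blinfun[of \<nu> "chi A"] norm_chi_le[of A] that by (simp add: is_mean_def)
  then show "bdd_above {blinfun_apply \<mu> (chi A) |\<mu>. is_mean \<mu> \<and> left_invariant \<mu>}"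
    by (auto simp: bdd_above_def)
qed

section \<open>The supremum defining the density\<close>

definition density_attained :: "'a::semigroup_mult set \<Rightarrow> real \<Rightarrow> bool" where
  "density_attained A \<alpha> \<longleftrightarrow>
     (\<forall>H\<in>Pf. \<forall>\<epsilon>>0. \<exists>K\<in>Pf. folner_approx H \<epsilon> K \<and> real (card (A \<inter> K)) \<ge> \<alpha> * real (card K))"

lemma folner_density_eq: "folner_density A = Sup {\<alpha>\<in>{0..1}. density_attained A \<alpha>}"
  by (simp add: folner_density_def density_attained_def)

text \<open>Attained values are closed downwards, and 0 is attained by the Strong Folner Condition,
  so the supremum is over a nonempty set. Negative \<beta> are allowed, as \<delta> - 1/(n+1) may be
  negative.\<close>

lemma density_attained_below:
  fixes A :: "'a::semigroup_mult set"
  assumes "strong_folner TYPE('a)" "\<beta> < folner_density A"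
  shows "density_attained A \<beta>"
proof -
  have "density_attained A 0" using assms(1) by (simp add: density_attained_def strong_folner_def)
  then have ne: "{\<alpha>\<in>{0..1}. density_attained A \<alpha>} \<noteq> {}" by force
  from less_cSupD[OF ne assms(2)[unfolded folner_density_eq]]
  obtain \<alpha> where \<alpha>: "\<beta> < \<alpha>" "density_attained A \<alpha>" by blast
  have "\<beta> * real (card K) \<le> \<alpha> * real (card K)" for K :: "'a set"
    using \<alpha>(1) by (intro mult_right_mono) auto
  then show ?thesis using \<alpha>(2) unfolding density_attained_def by (meson order_trans)
qed

lemma not_density_attained_above:
  assumes "folner_density A < \<beta>" "0 \<le> \<beta>" "\<beta> \<le> 1"
  shows "\<not> density_attained A \<beta>"
proof
  assume "density_attained A \<beta>"
  then have "\<beta> \<le> folner_density A"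
    unfolding folner_density_eq using assms(2,3)
    by (intro cSup_upper) (auto intro: bdd_aboveI[where M = 1])
  with assms(1) show False by simp
qed

lemma folner_density_nonneg:
  assumes "strong_folner TYPE('a::semigroup_mult)"
  shows "0 \<le> folner_density (A :: 'a set)"
  unfolding folner_density_eq using assms
  by (intro cSup_upper)
     (auto intro: bdd_aboveI[where M = 1] simp: density_attained_def strong_folner_def)

lemma folner_approx_mono:
  assumes "folner_approx H \<epsilon> K" "H' \<subseteq> H" "\<epsilon> \<le> \<epsilon>'"
  shows "folner_approx H' \<epsilon>' K"
  unfolding folner_approx_def
proof
  fix s assume "s \<in> H'"
  then have "real (card (K - (*) s ` K)) < \<epsilon> * real (card K)"
    using assms(1,2) by (auto simp: folner_approx_def)
  also have "\<dots> \<le> \<epsilon>' * real (card K)" using assms(3) by (simp add: mult_right_mono)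
  finally show "real (card (K - (*) s ` K)) < \<epsilon>' * real (card K)" .
qed

section \<open>A Folner net realising the density\<close>

lemma density_folner_net_exists:
  fixes A :: "'a::semigroup_mult set"
  assumes sf: "strong_folner TYPE('a)"
  obtains D :: "('a set \<times> nat) set" and le F where "folner_net D le F"
    "((\<lambda>\<alpha>. real (card (F \<alpha> \<inter> A)) / real (card (F \<alpha>))) \<longlongrightarrow> folner_density A) (tails D le)"
proof -
  let ?\<delta> = "folner_density A"
  define D :: "('a set \<times> nat) set" where "D = Pf \<times> UNIV"
  define le :: "'a set \<times> nat \<Rightarrow> 'a set \<times> nat \<Rightarrow> bool"
    where "le = (\<lambda>(H, n) (H', n'). H \<subseteq> H' \<and> n \<le> n')"
  \<comment> \<open>\<open>Suc\<close> keeps the tolerance positive at \<open>n = 0\<close>.\<close>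
  let ?e = "\<lambda>n. 1 / real (Suc n)"
  have "\<exists>K\<in>Pf. folner_approx H (?e n) K \<and> (?\<delta> - ?e n) * real (card K) \<le> real (card (A \<inter> K))"
    if "H \<in> Pf" for H :: "'a set" and n
    using density_attained_below[OF sf, of "?\<delta> - ?e n" A] that by (simp add: density_attained_def)
  then have "\<forall>\<alpha>\<in>D. \<exists>K. K \<in> Pf \<and> folner_approx (fst \<alpha>) (?e (snd \<alpha>)) K \<and>
               (?\<delta> - ?e (snd \<alpha>)) * real (card K) \<le> real (card (A \<inter> K))"
    unfolding D_def by (auto simp: Bex_def)
  then obtain F where F: "\<And>\<alpha>. \<alpha> \<in> D \<Longrightarrow> F \<alpha> \<in> Pf"
      "\<And>\<alpha>. \<alpha> \<in> D \<Longrightarrow> folner_approx (fst \<alpha>) (?e (snd \<alpha>)) (F \<alpha>)"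
      "\<And>\<alpha>. \<alpha> \<in> D \<Longrightarrow> (?\<delta> - ?e (snd \<alpha>)) * real (card (F \<alpha>)) \<le> real (card (A \<inter> F \<alpha>))"
    by metis
  have pos: "0 < real (card (F \<alpha>))" if "\<alpha> \<in> D" for \<alpha>
    using F(1)[OF that] by (simp add: Pf_def card_gt_0_iff)
  have dir: "directed_set D le"
    unfolding directed_set_def
  proof (intro conjI ballI impI)
    have "{undefined} \<in> Pf" by (simp add: Pf_def)
    then show "D \<noteq> {}" by (auto simp: D_def)
    show "le a a" for a by (auto simp: le_def)
    show "le a c" if "le a b" "le b c" for a b c using that by (auto simp: le_def)
    fix a b assume "a \<in> D" "b \<in> D"
    then have "(fst a \<union> fst b, max (snd a) (snd b)) \<in> D" by (auto simp: D_def Pf_def)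
    moreover have "le a (fst a \<union> fst b, max (snd a) (snd b))" "le b (fst a \<union> fst b, max (snd a) (snd b))"
      by (auto simp: le_def split: prod.splits)
    ultimately show "\<exists>c\<in>D. le a c \<and> le b c" by blast
  qed
  \<comment> \<open>Beyond \<open>(H, n)\<close> the finite set grows and the tolerance shrinks, so
    any prescribed Folner condition holds on a whole tail. All the limits below rest on
    this.\<close>
  have approx: "eventually (\<lambda>\<alpha>. \<alpha> \<in> D \<and> ?e (snd \<alpha>) < \<epsilon> \<and> folner_approx H \<epsilon> (F \<alpha>)) (tails D le)"
    if "H \<in> Pf" "0 < \<epsilon>" for H \<epsilon>
  proof -
    obtain n where n: "?e n < \<epsilon>" using \<open>0 < \<epsilon>\<close> by (meson nat_approx_posE)
    show ?thesis unfolding eventually_tails[OF dir]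
    proof (intro bexI ballI impI conjI)
      show "(H, n) \<in> D" using that by (simp add: D_def)
      fix \<beta> assume \<beta>: "\<beta> \<in> D" "le (H, n) \<beta>"
      then show "\<beta> \<in> D" by simp
      have sub: "H \<subseteq> fst \<beta>" and "n \<le> snd \<beta>" using \<beta>(2) by (auto simp: le_def)
      then have "?e (snd \<beta>) \<le> ?e n" by (intro divide_left_mono) auto
      with n show less: "?e (snd \<beta>) < \<epsilon>" by simp
      show "folner_approx H \<epsilon> (F \<beta>)"
        by (rule folner_approx_mono[OF F(2)[OF \<beta>(1)] sub]) (use less in simp)
    qed
  qed
  have "((\<lambda>\<alpha>. real (card (F \<alpha> - (*) s ` F \<alpha>)) / real (card (F \<alpha>))) \<longlongrightarrow> 0) (tails D le)" for s
  proof (rule tendstoI)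
    fix \<epsilon> :: real assume "0 < \<epsilon>"
    then have "eventually (\<lambda>\<alpha>. \<alpha> \<in> D \<and> ?e (snd \<alpha>) < \<epsilon> \<and> folner_approx {s} \<epsilon> (F \<alpha>)) (tails D le)"
      by (intro approx) (auto simp: Pf_def)
    then show "eventually (\<lambda>\<alpha>. dist (real (card (F \<alpha> - (*) s ` F \<alpha>)) / real (card (F \<alpha>))) 0 < \<epsilon>) (tails D le)"
    proof (rule eventually_mono, elim conjE)
      fix \<alpha> assume "\<alpha> \<in> D" "folner_approx {s} \<epsilon> (F \<alpha>)"
      then show "dist (real (card (F \<alpha> - (*) s ` F \<alpha>)) / real (card (F \<alpha>))) 0 < \<epsilon>"
        using pos[of \<alpha>] by (simp add: folner_approx_def pos_divide_less_eq)
    qed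
  qed
  then have net: "folner_net D le F" using dir F(1) by (simp add: folner_net_def)
  have "((\<lambda>\<alpha>. real (card (F \<alpha> \<inter> A)) / real (card (F \<alpha>))) \<longlongrightarrow> ?\<delta>) (tails D le)"
  proof (rule order_tendstoI)
    fix a assume "a < ?\<delta>"
    \<comment> \<open>\<open>{undefined}\<close> serves as an arbitrary nonempty finite set; the
      estimate comes from the tolerance.\<close>
    then have "eventually (\<lambda>\<alpha>. \<alpha> \<in> D \<and> ?e (snd \<alpha>) < ?\<delta> - a \<and> folner_approx {undefined} (?\<delta> - a) (F \<alpha>))
                 (tails D le)"
      by (intro approx) (auto simp: Pf_def)
    then show "eventually (\<lambda>\<alpha>. a < real (card (F \<alpha> \<inter> A)) / real (card (F \<alpha>))) (tails D le)"
    proof (rule eventually_mono, elim conjE)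
      fix \<alpha> assume \<alpha>: "\<alpha> \<in> D" "?e (snd \<alpha>) < ?\<delta> - a"
      then have "a * real (card (F \<alpha>)) < (?\<delta> - ?e (snd \<alpha>)) * real (card (F \<alpha>))"
        using pos[OF \<alpha>(1)] by (intro mult_strict_right_mono) auto
      also note F(3)[OF \<alpha>(1)]
      finally show "a < real (card (F \<alpha> \<inter> A)) / real (card (F \<alpha>))"
        using pos[OF \<alpha>(1)] by (simp add: pos_less_divide_eq Int_commute)
    qed
  next
    fix a assume a: "?\<delta> < a"
    show "eventually (\<lambda>\<alpha>. real (card (F \<alpha> \<inter> A)) / real (card (F \<alpha>)) < a) (tails D le)"
    \<comment> \<open>The supremum ranges over [0,1], so its maximality speaks only about
      \<open>a \<le> 1\<close>; for larger \<open>a\<close> the ratio is trivially below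
      \<open>a\<close>.\<close>
    proof (cases "a \<le> 1")
      case True
      have "\<not> density_attained A a"
        using not_density_attained_above[OF a _ True] a folner_density_nonneg[OF sf, of A] by simp
      then obtain H \<epsilon> where H: "H \<in> Pf" "0 < \<epsilon>"
          and *: "\<And>K. K \<in> Pf \<Longrightarrow> folner_approx H \<epsilon> K \<Longrightarrow> real (card (A \<inter> K)) < a * real (card K)"
        unfolding density_attained_def by (auto simp: not_le)
      from approx[OF H] show ?thesis
        by (rule eventually_mono)
           (auto simp: pos_divide_less_eq[OF pos] Int_commute[of _ A] intro!: * F(1))
    next
      case False
      have "real (card (F \<alpha> \<inter> A)) / real (card (F \<alpha>)) < a" if "\<alpha> \<in> D" for \<alpha>
      proof -
        have "card (F \<alpha> \<inter> A) \<le> card (F \<alpha>)" using F(1)[OF that] by (intro card_mono) (auto simp: Pf_def)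
        then have "real (card (F \<alpha> \<inter> A)) / real (card (F \<alpha>)) \<le> 1" using pos[OF that] by simp
        with False show ?thesis by linarith
      qed
      then show ?thesis using eventually_tails_mem[OF dir] by (rule eventually_mono[rotated])
    qed
  qed
  with net show ?thesis by (rule that)
qed

text \<open>Evaluation at \<open>g\<close> is weak* continuous, so \<nu> at \<open>g\<close> is a
  cluster point of a convergent real net; by the Hausdorff property this can only be the
  limit.\<close>

lemma weak_star_cluster_point_eval:
  assumes "net_cluster_point weak_star D le x \<nu>"
    and lim: "((\<lambda>\<alpha>. blinfun_apply (x \<alpha>) g) \<longlongrightarrow> l) (tails D le)"
  shows "blinfun_apply \<nu> g = l"
proof (rule ccontr)
  assume "blinfun_apply \<nu> g \<noteq> l"
  then obtain U V where UV: "open U" "open V" "blinfun_apply \<nu> g \<in> U" "l \<in> V" "U \<inter> V = {}"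
    using hausdorff by metis
  have "openin weak_star {f. blinfun_apply f g \<in> U}"
    using openin_continuous_map_preimage[OF strong_operator_topology_continuous_evaluation[of g], of U] UV(1)
    by (simp add: strong_operator_topology_topspace)
  with assms(1) UV(3) have "\<exists>\<^sub>F \<alpha> in tails D le. blinfun_apply (x \<alpha>) g \<in> U"
    by (auto simp: net_cluster_point_def)
  moreover have "\<forall>\<^sub>F \<alpha> in tails D le. blinfun_apply (x \<alpha>) g \<in> V"
    using topological_tendstoD[OF lim UV(2,4)] .
  ultimately have "\<exists>\<^sub>F \<alpha> in tails D le. blinfun_apply (x \<alpha>) g \<in> U \<and> blinfun_apply (x \<alpha>) g \<in> V"
    by (rule frequently_eventually_frequently)
  then show False using UV(5) by (auto dest: frequently_ex)
qed

theorem theorem1p13: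
  fixes A :: "'a::semigroup_mult set" and \<delta> :: real
  assumes "strong_folner TYPE('a)"
    and "\<delta> = folner_density A"
  shows "(\<exists>(D :: 'a net_index set) le F.
            folner_net D le F \<and>
            ((\<lambda>\<alpha>. real (card (F \<alpha> \<inter> A)) / real (card (F \<alpha>))) \<longlongrightarrow> \<delta>) (tails D le) \<and>
            (\<forall>\<nu>. net_cluster_point weak_star D le (\<lambda>\<alpha>. mu (F \<alpha>)) \<nu> \<longrightarrow>
                 \<nu> \<in> LIM0 \<and> blinfun_apply \<nu> (chi A) = \<delta>))
         \<and> folner_density A \<le> banach_density A"
proof -
  obtain D0 :: "('a set \<times> nat) set" and le0 F0 where F0: "folner_net D0 le0 F0"
    and lim0: "((\<lambda>\<alpha>. real (card (F0 \<alpha> \<inter> A)) / real (card (F0 \<alpha>))) \<longlongrightarrow> \<delta>) (tails D0 le0)"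
    unfolding assms(2) by (rule density_folner_net_exists[OF assms(1)])
  \<comment> \<open>The net found above has indices in \<open>'a set \<times> nat\<close>.
    Reindexing to the type in the statement keeps the image filter, through which the limit of the
    densities factors.\<close>
  obtain D :: "'a net_index set" and le F where F: "folner_net D le F"
    and eq: "filtermap F (tails D le) = filtermap F0 (tails D0 le0)"
    by (rule folner_net_reindex[OF F0])
  let ?d = "\<lambda>K. real (card (K \<inter> A)) / real (card K)"
  have "filterlim ?d (nhds \<delta>) (filtermap F0 (tails D0 le0))"
    using lim0 by (simp add: filterlim_filtermap)
  then have lim: "((\<lambda>\<alpha>. ?d (F \<alpha>)) \<longlongrightarrow> \<delta>) (tails D le)"
    unfolding eq[symmetric] by (simp add: filterlim_filtermap)
  have dir: "directed_set D le" using F by (simp add: folner_net_def)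
  have "eventually (\<lambda>\<alpha>. ?d (F \<alpha>) = blinfun_apply (mu (F \<alpha>)) (chi A)) (tails D le)"
    using eventually_tails_mem[OF dir]
    by (rule eventually_mono) (use F in \<open>auto simp: mu_chi folner_net_def Pf_def\<close>)
  then have "((\<lambda>\<alpha>. blinfun_apply (mu (F \<alpha>)) (chi A)) \<longlongrightarrow> \<delta>) (tails D le)"
    by (rule Lim_transform_eventually[OF lim])
  then have "\<forall>\<nu>. net_cluster_point weak_star D le (\<lambda>\<alpha>. mu (F \<alpha>)) \<nu> \<longrightarrow>
               \<nu> \<in> LIM0 \<and> blinfun_apply \<nu> (chi A) = \<delta>"
    using LIM0_I[OF F] weak_star_cluster_point_eval by blast
  \<comment> \<open>The implication for all cluster points could hold vacuously, so a mean with
    value \<delta> is taken from the compactness argument.\<close>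
  moreover obtain \<mu> where "is_mean \<mu>" "left_invariant \<mu>" "blinfun_apply \<mu> (chi A) = \<delta>"
    using left_invariant_mean_of_folner_net[OF F lim] .
  then have "folner_density A \<le> banach_density A"
    using le_banach_density[of \<mu> A] assms(2) by simp
  ultimately show ?thesis using F lim by blast
qed

end
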